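(* Let $f:[\ell,u]\to\mathbb R$ be a nonlinear, bounded and differentiable univariate function that admits a base partition $p_f^0$, let $\mathcal X=\{(x,y)\in[\ell,u]\times\mathbb R: y=f(x)\}$, and let $p_0=p_f^0,p_1,p_2,\dots$ be any infinite sequence of partitions of $[\ell,u]$ generated by the maximal-bound interval-bisection procedure. Let $\operatorname{Proj}_{x,y}\mathcal R^{lp}(f,p_k)$ be the projection onto the $(x,y)$-space of the LP relaxation of the MILP formulation $\mathcal R(f,p_k)$. Then $$\lim_{k\to\infty}\operatorname{Proj}_{x,y}\mathcal R^{lp}(f,p_k)=\operatorname{conv}(\mathcal X),$$ where the convergence of sets is in the sense that $d_H\big(\operatorname{Proj}_{x,y}\mathcal R^{lp}(f,p_k),\operatorname{conv}(\mathcal X)\big)\to 0$ as $k\to\infty$, with $d_H$ the Hausdorff distance.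
   Context: Function: $f:[\ell,u]\to\mathbb R$ ($\ell<u$) is nonlinear (not affine), bounded and differentiable on $[\ell,u]$ (one-sided derivatives at the endpoints). Partitions: a partition $p$ of $[\ell,u]$ is a finite sequence $(x_0,\dots,x_k)$ with $\ell=x_0<x_1<\dots<x_k=u$; $\mathcal P(p)=\{x_0,\dots,x_k\}$; the intervals $[x_{i-1},x_i]$, $i=1,\dots,k$, are its sub-intervals. A break point of $f$ is a point of $[\ell,u]$ at which $f$ changes from convex to concave or vice versa. A base partition $p_f^0$ of $f$ is a partition such that (i) every break point of $f$ is in $\mathcal P(p_f^0)$, (ii) $f'(x_{i-1})\ne f'(x_i)$ for every sub-interval $[x_{i-1},x_i]$, and (iii) $|\mathcal P(p_f^0)|$ is minimum. To make it unique, one takes the break points of $f$ together with $\ell,u$, and adds the midpoint of every resulting sub-interval at whose endpoints $f'$ takes equal values. It is assumed that $f$ has such a (finite) base partition and that $f$ is convex or concave on each of its sub-intervals. An interval bisection of a partition adds one new partition point, the midpoint of one of its sub-intervals. A partition is admissible for $f$ if it is $p_f^0$ or is obtained from $p_f^0$ by a finite sequence of interval bisections. MILP formulation: let $p=(x_0,\dots,x_k)$ be admissible. Let $\bm v_i=(x_i,f(x_i))$ for $i=0,\dots,k$, and for $i=1,\dots,k$ let $\bm v_{i-1,i}$ be the intersection point of the tangent lines to $y=f(x)$ at $\bm v_{i-1}$ and $\bm v_i$ (if these two tangents coincide, i.e. $f$ is affine on $[x_{i-1},x_i]$, $\bm v_{i-1,i}$ is taken to be any point of the segment from $\bm v_{i-1}$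 to $\bm v_i$). Superscripts $x,y$ denote coordinates of a point. $\mathcal R(f,p)$ is the set of $(x,y,\bm\delta,\bm z)$, $\bm\delta=(\delta_1^i,\delta_2^i)_{i=1}^k$, $\bm z=(z_1,\dots,z_{k-1})$, satisfying $$y=v_0^y+\sum_{i=1}^k\{\delta_1^i(v_{i-1,i}^y-v_{i-1}^y)+\delta_2^i(v_i^y-v_{i-1}^y)\},$$ $$x=v_0^x+\sum_{i=1}^k\{\delta_1^i(v_{i-1,i}^x-v_{i-1}^x)+\delta_2^i(v_i^x-v_{i-1}^x)\},$$ $$\delta_1^1+\delta_2^1\le 1,\qquad \delta_1^i+\delta_2^i\le z_{i-1}\le\delta_2^{i-1}\ (i=2,\dots,k),$$ $$0\le\delta_1^i,\delta_2^i\le 1\ (i=1,\dots,k),\qquad z_i\in\{0,1\}\ (i=1,\dots,k-1).$$ $\mathcal R^{lp}(f,p)$ is its LP relaxation, obtained by replacing $z_i\in\{0,1\}$ with $0\le z_i\le1$. $\operatorname{Proj}_{x,y}$ denotes projection onto the $(x,y)$ coordinates. Maximal-bound interval-bisection procedure: $p_0=p_f^0$. Given $p_k$, compute for each sub-interval $[a,b]$ of $p_k$ the number $\frac{(b-a)|f'(a)-f'(b)|}{4}$; choose a sub-interval for which this number is maximal (ties broken arbitrarily), and obtain $p_{k+1}$ from $p_k$ by adding the midpoint of that sub-interval as a new partition point. Hausdorff distance of closed (here compact, nonempty) sets $A,B\subset\mathbb R^2$: $d_H(A,B)=\max\{\max_{a\in A}\min_{b\in B}d(a,b),\ \max_{b\in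 B}\min_{a\in A}d(a,b)\}$ with $d$ the Euclidean distance. *)

theory Defs
  imports "HOL-Analysis.Analysis"
begin

section \<open>Partitions\<close>

text \<open>A partition \<open>l = x\<^sub>0 < \<dots> < x\<^sub>k = u\<close> is the list of its points; \<open>p ! i\<close> is \<open>x\<^sub>i\<close>,
  and \<open>length p = k + 1\<close>.\<close>

definition is_partition :: "real \<Rightarrow> real \<Rightarrow> real list \<Rightarrow> bool" where
  "is_partition l u p \<longleftrightarrow> p \<noteq> [] \<and> hd p = l \<and> last p = u \<and> sorted_wrt (<) p"

text \<open>The requirement that \<open>f\<close> is neither convex nor concave on any small neighbourhood of \<open>c\<close>
  makes this a genuine change of curvature: an affine function is both convex and concave, so
  without it every inner point of an affine piece would qualify.\<close>

definition break_points :: "(real \<Rightarrow> real) \<Rightarrow> real \<Rightarrow> real \<Rightarrow> real set" where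
  "break_points f l u = {c. \<exists>e>0. {c - e..c + e} \<subseteq> {l..u} \<and>
     (convex_on {c - e..c} f \<and> concave_on {c..c + e} f \<or>
      concave_on {c - e..c} f \<and> convex_on {c..c + e} f) \<and>
     (\<forall>d. 0 < d \<and> d \<le> e \<longrightarrow>
        \<not> convex_on {c - d..c + d} f \<and> \<not> concave_on {c - d..c + d} f)}"

definition separating_partition ::
    "(real \<Rightarrow> real) \<Rightarrow> (real \<Rightarrow> real) \<Rightarrow> real \<Rightarrow> real \<Rightarrow> real list \<Rightarrow> bool" where
  "separating_partition f f' l u p \<longleftrightarrow> is_partition l u p \<and> break_points f l u \<subseteq> set p \<and>
     (\<forall>i. Suc i < length p \<longrightarrow> f' (p ! i) \<noteq> f' (p ! Suc i))"

definition base_points ::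
    "(real \<Rightarrow> real) \<Rightarrow> (real \<Rightarrow> real) \<Rightarrow> real \<Rightarrow> real \<Rightarrow> real set" where
  "base_points f f' l u = (let B = {l, u} \<union> break_points f l u in
     B \<union> {(a + b) / 2 | a b. a \<in> B \<and> b \<in> B \<and> a < b \<and> {a<..<b} \<inter> B = {} \<and> f' a = f' b})"

text \<open>The last conjunct is the normalization that makes the base partition unique.\<close>

definition is_base_partition ::
    "(real \<Rightarrow> real) \<Rightarrow> (real \<Rightarrow> real) \<Rightarrow> real \<Rightarrow> real \<Rightarrow> real list \<Rightarrow> bool" where
  "is_base_partition f f' l u p \<longleftrightarrow> separating_partition f f' l u p \<and>
     (\<forall>q. separating_partition f f' l u q \<longrightarrow> card (set p) \<le> card (set q)) \<and>
     set p = base_points f f' l u"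


section \<open>The maximal-bound interval-bisection procedure\<close>

definition bisect :: "real list \<Rightarrow> nat \<Rightarrow> real list" where
  "bisect p i = take (Suc i) p @ [(p ! i + p ! Suc i) / 2] @ drop (Suc i) p"

definition interval_bound :: "(real \<Rightarrow> real) \<Rightarrow> real \<Rightarrow> real \<Rightarrow> real" where
  "interval_bound f' a b = (b - a) * \<bar>f' a - f' b\<bar> / 4"

definition max_bound_bisection :: "(real \<Rightarrow> real) \<Rightarrow> real list \<Rightarrow> real list \<Rightarrow> bool" where
  "max_bound_bisection f' p q \<longleftrightarrow> (\<exists>i. Suc i < length p \<and>
     (\<forall>j. Suc j < length p \<longrightarrow>
        interval_bound f' (p ! j) (p ! Suc j) \<le> interval_bound f' (p ! i) (p ! Suc i)) \<and>
     q = bisect p i)"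


section \<open>The MILP formulation and its LP relaxation\<close>

definition tangent_line :: "(real \<Rightarrow> real) \<Rightarrow> (real \<Rightarrow> real) \<Rightarrow> real \<Rightarrow> (real \<times> real) set" where
  "tangent_line f f' a = {(x, y). y = f a + f' a * (x - a)}"

definition is_tangent_vertex ::
    "(real \<Rightarrow> real) \<Rightarrow> (real \<Rightarrow> real) \<Rightarrow> real \<Rightarrow> real \<Rightarrow> real \<times> real \<Rightarrow> bool" where
  "is_tangent_vertex f f' a b v \<longleftrightarrow>
     (if tangent_line f f' a = tangent_line f f' b
      then v \<in> closed_segment (a, f a) (b, f b)
      else v \<in> tangent_line f f' a \<inter> tangent_line f f' b)"

text \<open>\<open>w i\<close>, for \<open>1 \<le> i \<le> k\<close>, is an admissible choice of the point \<open>v\<^bsub>i-1,i\<^esub>\<close>.\<close>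

definition tangent_vertices ::
    "(real \<Rightarrow> real) \<Rightarrow> (real \<Rightarrow> real) \<Rightarrow> real list \<Rightarrow> (nat \<Rightarrow> real \<times> real) \<Rightarrow> bool" where
  "tangent_vertices f f' p w \<longleftrightarrow>
     (\<forall>i\<in>{1..length p - 1}. is_tangent_vertex f f' (p ! (i - 1)) (p ! i) (w i))"

text \<open>The points \<open>(x, y, \<delta>\<^sub>1, \<delta>\<^sub>2, z)\<close> of the formulation, with each \<open>z\<^sub>i\<close> ranging over \<open>Z\<close>.
  Finite vectors are functions on their index set, \<open>undefined\<close> elsewhere.\<close>

definition incremental_system ::
    "real set \<Rightarrow> (real \<Rightarrow> real) \<Rightarrow> real list \<Rightarrow> (nat \<Rightarrow> real \<times> real) \<Rightarrow>
      (real \<times> real \<times> (nat \<Rightarrow> real) \<times> (nat \<Rightarrow> real) \<times> (nat \<Rightarrow> real)) set" where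
  "incremental_system Z f p w = {(x, y, \<delta>1, \<delta>2, z).
     (let k = length p - 1; v = (\<lambda>i. (p ! i, f (p ! i))) in
       y = snd (v 0) + (\<Sum>i=1..k. \<delta>1 i * (snd (w i) - snd (v (i - 1)))
                                   + \<delta>2 i * (snd (v i) - snd (v (i - 1)))) \<and>
       x = fst (v 0) + (\<Sum>i=1..k. \<delta>1 i * (fst (w i) - fst (v (i - 1)))
                                   + \<delta>2 i * (fst (v i) - fst (v (i - 1)))) \<and>
       \<delta>1 1 + \<delta>2 1 \<le> 1 \<and>
       (\<forall>i\<in>{2..k}. \<delta>1 i + \<delta>2 i \<le> z (i - 1) \<and> z (i - 1) \<le> \<delta>2 (i - 1)) \<and>
       \<delta>1 \<in> {1..k} \<rightarrow>\<^sub>E {0..1} \<and> \<delta>2 \<in> {1..k} \<rightarrow>\<^sub>E {0..1} \<and> z \<in> {1..<k} \<rightarrow>\<^sub>E Z)}"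

definition milp_formulation ::
    "(real \<Rightarrow> real) \<Rightarrow> real list \<Rightarrow> (nat \<Rightarrow> real \<times> real) \<Rightarrow>
      (real \<times> real \<times> (nat \<Rightarrow> real) \<times> (nat \<Rightarrow> real) \<times> (nat \<Rightarrow> real)) set" where
  "milp_formulation = incremental_system {0, 1}"

definition lp_relaxation ::
    "(real \<Rightarrow> real) \<Rightarrow> real list \<Rightarrow> (nat \<Rightarrow> real \<times> real) \<Rightarrow>
      (real \<times> real \<times> (nat \<Rightarrow> real) \<times> (nat \<Rightarrow> real) \<times> (nat \<Rightarrow> real)) set" where
  "lp_relaxation = incremental_system {0..1}"

definition proj_xy :: "('a \<times> 'b \<times> 'c) set \<Rightarrow> ('a \<times> 'b) set" where
  "proj_xy S = (\<lambda>(x, y, _). (x, y)) ` S"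


section \<open>Hausdorff distance\<close>

text \<open>Intended for nonempty compact sets, where all suprema and infima are attained.\<close>

definition hausdorff_dist :: "'a::metric_space set \<Rightarrow> 'a set \<Rightarrow> real" where
  "hausdorff_dist A B = max (SUP a\<in>A. infdist a B) (SUP b\<in>B. infdist b A)"

end

theory Submission
  imports Defs
begin

text \<open>
  The relaxation projects onto the convex hull of the vertices \<open>v\<^sub>0, \<dots>, v\<^sub>k\<close> and the tangent
  intersections (\<open>proj_lp_relaxation\<close>).  Indeed a relaxed \<open>z\<close> exists as soon as each \<open>\<delta>\<^sub>1 + \<delta>\<^sub>2\<close> is at
  most the preceding \<open>\<delta>\<^sub>2\<close>, and the \<open>\<delta>\<close> subject to this condition are a change of coordinates for the
  weights of a convex combination: \<open>\<delta>\<^sub>1\<close> is the weight of the tangent intersection, and the amount by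
  which \<open>\<delta>\<^sub>2\<close> exceeds the next \<open>\<delta>\<^sub>1 + \<delta>\<^sub>2\<close> is the weight of the vertex.  So two convex hulls have to
  be compared, and it suffices to place the generators of each near the other hull
  (\<open>hausdorff_dist_convex_hulls\<close>).

  On a sub-interval \<open>[a, b]\<close> the chord from \<open>(a, f a)\<close> to \<open>(b, f b)\<close> belongs to both hulls.  As \<open>f\<close> is
  convex or concave there, the slopes of all its chords and tangents lie between \<open>f' a\<close> and
  \<open>f' b\<close>, so that both the graph of \<open>f\<close> (\<open>graph_near_chord\<close>) and the tangent intersection
  (\<open>tangent_vertex_near_chord\<close>) stay within \<open>(b - a) \<bar>f' a - f' b\<bar>\<close> of the chord.  Hence the
  Hausdorff distance is at most four times the maximal interval bound.

  It remains to see that the maximal bound tends to 0.  The mesh of the partitions is of no help: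
  an interval on which \<open>f\<close> is affine has bound 0 and may stay undivided forever.  Instead,
  consider the sum of all interval bounds.  Since \<open>f'\<close> is monotone on each
  sub-interval, the bounds of the two halves of an interval add up to half its bound, so each step
  lowers the sum by exactly half of the maximal bound (\<open>total_interval_bound_bisect\<close>).  The sum is
  decreasing and nonnegative, hence convergent, and its decrements tend to 0.
\<close>

section \<open>Convex hulls and the Hausdorff distance\<close>

lemma hausdorff_dist_le:
  assumes "A \<noteq> {}" "B \<noteq> {}"
    and "\<And>a. a \<in> A \<Longrightarrow> infdist a B \<le> e" "\<And>b. b \<in> B \<Longrightarrow> infdist b A \<le> e"
  shows "hausdorff_dist A B \<le> e"
  unfolding hausdorff_dist_def using assms by (auto intro!: cSUP_least)

lemma hausdorff_dist_nonneg:
  assumes "A \<noteq> {}" and "\<And>a. a \<in> A \<Longrightarrow> infdist a B \<le> e"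
  shows "0 \<le> hausdorff_dist A B"
proof -
  obtain a where a: "a \<in> A"
    using assms(1) by blast
  have "bdd_above ((\<lambda>a. infdist a B) ` A)"
    using assms(2) by (rule bdd_aboveI2)
  from cSUP_upper2[OF this a infdist_nonneg] show ?thesis
    unfolding hausdorff_dist_def by linarith
qed

text \<open>The points \<open>c + d\<close> with \<open>c \<in> C\<close> and \<open>norm d \<le> e\<close> form a convex set, as a Minkowski sum of convex
  sets, so once it contains \<open>S\<close> it contains the convex hull of \<open>S\<close>.  This is what reduces
  distances between convex hulls to distances from their generators.\<close>

lemma infdist_convex_hull_le:
  fixes C :: "'a::real_normed_vector set"
  assumes "convex C" and near: "\<And>s. s \<in> S \<Longrightarrow> \<exists>c\<in>C. dist s c \<le> e"
    and "x \<in> convex hull S"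
  shows "infdist x C \<le> e"
proof -
  define N where "N = (\<Union>c\<in>C. \<Union>d\<in>cball 0 e. {c + d})"
  have "convex N"
    unfolding N_def using \<open>convex C\<close> convex_cball by (rule convex_sums)
  moreover have "S \<subseteq> N"
  proof
    fix s assume "s \<in> S"
    then obtain c where "c \<in> C" "dist s c \<le> e"
      using near by blast
    then have "s - c \<in> cball 0 e" "s = c + (s - c)"
      by (auto simp: dist_norm norm_minus_commute)
    with \<open>c \<in> C\<close> show "s \<in> N"
      unfolding N_def by blast
  qed
  ultimately have "x \<in> N"
    using \<open>x \<in> convex hull S\<close> hull_minimal[of S N convex] by blast
  then obtain c d where "c \<in> C" "norm d \<le> e" "x = c + d"
    unfolding N_def by auto
  then show ?thesis
    by (intro infdist_le2[of c]) (auto simp: dist_norm)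
qed

text \<open>The lower bound \<open>0\<close> relies on the generators being uniformly close: the suprema in
  \<^const>\<open>hausdorff_dist\<close> are unconstrained reals unless their sets are bounded.\<close>

lemma hausdorff_dist_convex_hulls:
  fixes S T :: "'a::real_normed_vector set"
  assumes "S \<noteq> {}" "T \<noteq> {}"
    and S: "\<And>s. s \<in> S \<Longrightarrow> \<exists>t\<in>convex hull T. dist s t \<le> e"
    and T: "\<And>t. t \<in> T \<Longrightarrow> \<exists>s\<in>convex hull S. dist t s \<le> e"
  shows "hausdorff_dist (convex hull S) (convex hull T) \<in> {0..e}"
proof -
  have ne: "convex hull S \<noteq> {}" "convex hull T \<noteq> {}"
    using assms(1,2) by auto
  have 1: "infdist x (convex hull T) \<le> e" if "x \<in> convex hull S" for x
    using infdist_convex_hull_le[OF convex_convex_hull S that] .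
  have 2: "infdist x (convex hull S) \<le> e" if "x \<in> convex hull T" for x
    using infdist_convex_hull_le[OF convex_convex_hull T that] .
  show ?thesis
    using hausdorff_dist_le[OF ne 1 2] hausdorff_dist_nonneg[OF ne(1) 1] by auto
qed

section \<open>The projection of the LP relaxation\<close>

text \<open>The constraints on the continuous variables that remain after eliminating the relaxed \<open>z\<close>, which
  only has to fit between \<open>\<alpha> i + \<beta> i\<close> and \<open>\<beta> (i - 1)\<close>.  The constant 1 plays the role of
  \<open>\<beta> 0\<close>, which makes the first constraint an instance of the general one.\<close>

definition incremental_weights :: "nat \<Rightarrow> (nat \<Rightarrow> real) \<Rightarrow> (nat \<Rightarrow> real) \<Rightarrow> bool" where
  "incremental_weights n \<alpha> \<beta> \<longleftrightarrow>
     (\<forall>i\<in>{1..n}. 0 \<le> \<alpha> i \<and> 0 \<le> \<beta> i \<and> \<alpha> i + \<beta> i \<le> (if i = 1 then 1 else \<beta> (i - 1)))"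

definition incremental_point ::
    "nat \<Rightarrow> (nat \<Rightarrow> 'a) \<Rightarrow> (nat \<Rightarrow> 'a) \<Rightarrow> (nat \<Rightarrow> real) \<Rightarrow> (nat \<Rightarrow> real) \<Rightarrow> 'a::real_vector" where
  "incremental_point n v w \<alpha> \<beta> =
     v 0 + (\<Sum>i=1..n. \<alpha> i *\<^sub>R (w i - v (i - 1)) + \<beta> i *\<^sub>R (v i - v (i - 1)))"

text \<open>The first \<open>n\<close> increments, followed by a step of length \<open>d \<le> \<beta> n\<close> in the direction from \<open>v n\<close> to
  any \<open>q \<in> C\<close>, do not leave \<open>C\<close>.  Allowing such an extra step makes the statement inductive: the
  increments with index \<open>n + 1\<close> and the extra step add up to \<open>s (r - v n)\<close> with
  \<open>s = \<alpha> (n + 1) + \<beta> (n + 1) \<le> \<beta> n\<close> and \<open>r\<close> a convex combination of \<open>w (n + 1)\<close>,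
  \<open>v (n + 1)\<close> and \<open>q\<close>, which is again a single extra step.\<close>

lemma incremental_point_step_in_convex:
  assumes "convex C" and v: "\<And>i. i \<le> n \<Longrightarrow> v i \<in> C"
    and w: "\<And>i. 1 \<le> i \<Longrightarrow> i \<le> n \<Longrightarrow> w i \<in> C"
    and "incremental_weights n \<alpha> \<beta>"
    and "0 \<le> d" "d \<le> (if n = 0 then 1 else \<beta> n)" "q \<in> C"
  shows "incremental_point n v w \<alpha> \<beta> + d *\<^sub>R (q - v n) \<in> C"
  using v w assms(4-7)
proof (induction n arbitrary: d q)
  case 0
  have "(1 - d) *\<^sub>R v 0 + d *\<^sub>R q \<in> C"
    using 0 \<open>convex C\<close> by (intro convexD) auto
  then show ?case
    by (simp add: incremental_point_def algebra_simps)
next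
  case (Suc n)
  define s where "s = \<alpha> (Suc n) + \<beta> (Suc n)"
  have weights: "0 \<le> \<alpha> (Suc n)" "0 \<le> \<beta> (Suc n)" "s \<le> (if n = 0 then 1 else \<beta> n)"
    using Suc.prems(3)[unfolded incremental_weights_def, rule_format, of "Suc n"]
    by (auto simp: s_def split: if_splits)
  have mem: "v (Suc n) \<in> C" "w (Suc n) \<in> C" "q \<in> C" and d: "0 \<le> d" "d \<le> \<beta> (Suc n)"
    using Suc.prems by auto
  have "\<exists>r\<in>C. s *\<^sub>R r = \<alpha> (Suc n) *\<^sub>R w (Suc n) + (\<beta> (Suc n) - d) *\<^sub>R v (Suc n) + d *\<^sub>R q"
  proof (cases "s = 0")
    case True
    then have "\<alpha> (Suc n) = 0" "\<beta> (Suc n) = 0" "d = 0"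
      using weights d by (auto simp: s_def)
    then show ?thesis
      using mem True by auto
  next
    case False
    then have "0 < s"
      using weights by (auto simp: s_def)
    define r where "r = (\<alpha> (Suc n) / s) *\<^sub>R w (Suc n) + ((\<beta> (Suc n) - d) / s) *\<^sub>R v (Suc n)
      + (d / s) *\<^sub>R q"
    have "\<alpha> (Suc n) / s + (\<beta> (Suc n) - d) / s + d / s = 1"
      using \<open>0 < s\<close> by (simp add: s_def flip: add_divide_distrib)
    then have "r \<in> convex hull {w (Suc n), v (Suc n), q}"
      unfolding convex_hull_3 r_def using weights d \<open>0 < s\<close>
      by (intro CollectI exI[of _ "\<alpha> (Suc n) / s"] exI[of _ "(\<beta> (Suc n) - d) / s"]
            exI[of _ "d / s"]) auto
    then have "r \<in> C"
      using hull_minimal[of "{w (Suc n), v (Suc n), q}" C convex] mem \<open>convex C\<close> by auto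
    moreover have "s *\<^sub>R r = \<alpha> (Suc n) *\<^sub>R w (Suc n) + (\<beta> (Suc n) - d) *\<^sub>R v (Suc n) + d *\<^sub>R q"
      using \<open>0 < s\<close> by (simp add: r_def scaleR_add_right)
    ultimately show ?thesis
      by blast
  qed
  then obtain r where r: "r \<in> C"
    "s *\<^sub>R r = \<alpha> (Suc n) *\<^sub>R w (Suc n) + (\<beta> (Suc n) - d) *\<^sub>R v (Suc n) + d *\<^sub>R q"
    by blast
  have "incremental_point (Suc n) v w \<alpha> \<beta> + d *\<^sub>R (q - v (Suc n)) =
      incremental_point n v w \<alpha> \<beta> + (s *\<^sub>R r - s *\<^sub>R v n)"
    unfolding r(2) by (simp add: incremental_point_def s_def algebra_simps)
  also have "\<dots> = incremental_point n v w \<alpha> \<beta> + s *\<^sub>R (r - v n)"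
    by (simp add: scaleR_diff_right)
  also have "\<dots> \<in> C"
  proof (rule Suc.IH)
    show "incremental_weights n \<alpha> \<beta>"
      using Suc.prems(3) by (auto simp: incremental_weights_def)
  qed (use Suc.prems weights r in \<open>auto simp: s_def\<close>)
  finally show ?case .
qed

lemma incremental_point_convex_combination:
  assumes "s + t = 1"
  shows "s *\<^sub>R incremental_point n v w \<alpha> \<beta> + t *\<^sub>R incremental_point n v w \<alpha>' \<beta>' =
    incremental_point n v w (\<lambda>i. s * \<alpha> i + t * \<alpha>' i) (\<lambda>i. s * \<beta> i + t * \<beta>' i)"
proof -
  have "v 0 = s *\<^sub>R v 0 + t *\<^sub>R v 0"
    using assms by (simp flip: scaleR_add_left)
  moreover have "(\<Sum>i=1..n. (s * \<alpha> i + t * \<alpha>' i) *\<^sub>R (w i - v (i - 1)) +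
        (s * \<beta> i + t * \<beta>' i) *\<^sub>R (v i - v (i - 1))) =
      s *\<^sub>R (\<Sum>i=1..n. \<alpha> i *\<^sub>R (w i - v (i - 1)) + \<beta> i *\<^sub>R (v i - v (i - 1))) +
      t *\<^sub>R (\<Sum>i=1..n. \<alpha>' i *\<^sub>R (w i - v (i - 1)) + \<beta>' i *\<^sub>R (v i - v (i - 1)))"
    unfolding scaleR_sum_right sum.distrib[symmetric]
    by (intro sum.cong) (simp_all add: scaleR_add_left scaleR_add_right)
  ultimately show ?thesis
    unfolding incremental_point_def by (simp add: scaleR_add_right)
qed

lemma incremental_weights_convex_combination:
  assumes "incremental_weights n \<alpha> \<beta>" "incremental_weights n \<alpha>' \<beta>'"
    and "0 \<le> s" "0 \<le> t" "s + t = 1"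
  shows "incremental_weights n (\<lambda>i. s * \<alpha> i + t * \<alpha>' i) (\<lambda>i. s * \<beta> i + t * \<beta>' i)"
  unfolding incremental_weights_def
proof
  fix i assume i: "i \<in> {1..n}"
  let ?c = "\<lambda>\<beta>. if i = 1 then 1 else \<beta> (i - 1)"
  have 1: "0 \<le> \<alpha> i" "0 \<le> \<beta> i" "\<alpha> i + \<beta> i \<le> ?c \<beta>" "0 \<le> \<alpha>' i" "0 \<le> \<beta>' i" "\<alpha>' i + \<beta>' i \<le> ?c \<beta>'"
    using assms(1,2) i unfolding incremental_weights_def by blast+
  have "s * (\<alpha> i + \<beta> i) + t * (\<alpha>' i + \<beta>' i) \<le> s * ?c \<beta> + t * ?c \<beta>'"
    using 1 assms by (intro add_mono mult_left_mono) auto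
  then show "0 \<le> s * \<alpha> i + t * \<alpha>' i \<and> 0 \<le> s * \<beta> i + t * \<beta>' i \<and>
      s * \<alpha> i + t * \<alpha>' i + (s * \<beta> i + t * \<beta>' i)
      \<le> (if i = 1 then 1 else s * \<beta> (i - 1) + t * \<beta>' (i - 1))"
    using 1 assms by (auto simp: algebra_simps)
qed

lemma incremental_point_staircase:
  assumes "j \<le> n"
  shows "incremental_point n v w (\<lambda>_. 0) (\<lambda>i. if i \<le> j then 1 else 0) = v j"
  using assms
proof (induction n)
  case (Suc n)
  show ?case
  proof (cases "j = Suc n")
    case True
    have "incremental_point (Suc n) v w (\<lambda>_. 0) (\<lambda>i. if i \<le> j then 1 else 0) =
        v 0 + (\<Sum>i=Suc 0..Suc n. v i - v (i - 1))"
      unfolding incremental_point_def by (intro arg_cong2[of _ _ _ _ "(+)"] sum.cong) (auto simp: True)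
    also have "\<dots> = v j"
      by (subst sum_telescope'') (auto simp: True)
    finally show ?thesis .
  next
    case False
    then show ?thesis
      using Suc by (auto simp: incremental_point_def)
  qed
qed (auto simp: incremental_point_def)

text \<open>The vertices \<open>v j\<close> and \<open>w j\<close> arise from 0-1 weights: full increments up to \<open>v j\<close>, or up to
  \<open>v (j - 1)\<close> followed by a full step to \<open>w j\<close>.  Since the weights form a convex set, all convex
  combinations of the vertices are reached; no other point is, by
  \<open>incremental_point_step_in_convex\<close> with an extra step of length 0.\<close>

lemma incremental_points_eq_convex_hull:
  "{incremental_point n v w \<alpha> \<beta> | \<alpha> \<beta>. incremental_weights n \<alpha> \<beta>} =
     convex hull (v ` {0..n} \<union> w ` {1..n})" (is "?I = convex hull ?V")
proof
  show "?I \<subseteq> convex hull ?V"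
  proof safe
    fix \<alpha> \<beta> assume *: "incremental_weights n \<alpha> \<beta>"
    have "incremental_point n v w \<alpha> \<beta> + 0 *\<^sub>R (v 0 - v n) \<in> convex hull ?V"
      using * by (intro incremental_point_step_in_convex)
        (auto simp: incremental_weights_def hull_inc)
    then show "incremental_point n v w \<alpha> \<beta> \<in> convex hull ?V"
      by simp
  qed
  have "convex ?I"
  proof (rule convexI)
    fix x y and s t :: real
    assume "x \<in> ?I" "y \<in> ?I" and st: "0 \<le> s" "0 \<le> t" "s + t = 1"
    then obtain \<alpha> \<beta> \<alpha>' \<beta>' where *: "incremental_weights n \<alpha> \<beta>" "incremental_weights n \<alpha>' \<beta>'"
      "x = incremental_point n v w \<alpha> \<beta>" "y = incremental_point n v w \<alpha>' \<beta>'"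
      by blast
    show "s *\<^sub>R x + t *\<^sub>R y \<in> ?I"
      unfolding *(3,4) incremental_point_convex_combination[OF st(3)]
      using incremental_weights_convex_combination[OF *(1,2) st] by blast
  qed
  moreover have "v j \<in> ?I" if "j \<le> n" for j
  proof -
    have "incremental_weights n (\<lambda>_. 0) (\<lambda>i. if i \<le> j then 1 else 0)"
      by (auto simp: incremental_weights_def)
    with incremental_point_staircase[OF that, of v w] show ?thesis
      by force
  qed
  moreover have "w j \<in> ?I" if j: "j \<in> {1..n}" for j
  proof -
    let ?\<alpha> = "\<lambda>i. if i = j then 1 else 0::real" and ?\<beta> = "\<lambda>i. if i \<le> j - 1 then 1 else 0::real"
    have "incremental_point n v w ?\<alpha> ?\<beta> =
        incremental_point n v w (\<lambda>_. 0) ?\<beta> + (\<Sum>i=1..n. ?\<alpha> i *\<^sub>R (w i - v (i - 1)))"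
      by (simp add: incremental_point_def sum.distrib add.assoc add.commute)
    also have "(\<Sum>i=1..n. ?\<alpha> i *\<^sub>R (w i - v (i - 1))) =
        (\<Sum>i=1..n. if i = j then w i - v (i - 1) else 0)"
      by (intro sum.cong) auto
    also have "\<dots> = w j - v (j - 1)"
      using j by simp
    also have "incremental_point n v w (\<lambda>_. 0) ?\<beta> = v (j - 1)"
      using j by (intro incremental_point_staircase) auto
    finally have "incremental_point n v w ?\<alpha> ?\<beta> = w j"
      by simp
    moreover have "incremental_weights n ?\<alpha> ?\<beta>"
      by (auto simp: incremental_weights_def)
    ultimately show ?thesis
      by force
  qed
  ultimately show "convex hull ?V \<subseteq> ?I"
    by (intro hull_minimal) auto
qed

lemma incremental_weights_le_1:
  assumes "incremental_weights n \<alpha> \<beta>" "1 \<le> i" "i \<le> n"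
  shows "\<alpha> i \<le> 1 \<and> \<beta> i \<le> 1"
  using assms(2,3)
proof (induction i rule: dec_induct)
  case base
  then show ?case
    using assms(1) by (force simp: incremental_weights_def)
next
  case (step i)
  then show ?case
    using assms(1)[unfolded incremental_weights_def, rule_format, of "Suc i"] by auto
qed

lemma proj_lp_relaxation:
  assumes "2 \<le> length p"
  shows "proj_xy (lp_relaxation f p w) =
    convex hull ((\<lambda>i. (p ! i, f (p ! i))) ` {0..length p - 1} \<union> w ` {1..length p - 1})"
proof -
  let ?n = "length p - 1" and ?v = "\<lambda>i. (p ! i, f (p ! i))"
  have point: "incremental_point ?n ?v w \<alpha> \<beta> =
     (fst (?v 0) + (\<Sum>i=1..?n. \<alpha> i * (fst (w i) - fst (?v (i - 1)))
                               + \<beta> i * (fst (?v i) - fst (?v (i - 1)))),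
      snd (?v 0) + (\<Sum>i=1..?n. \<alpha> i * (snd (w i) - snd (?v (i - 1)))
                               + \<beta> i * (snd (?v i) - snd (?v (i - 1)))))" for \<alpha> \<beta>
    by (intro prod_eqI) (simp_all add: incremental_point_def fst_sum snd_sum)
  have "proj_xy (lp_relaxation f p w) =
      {incremental_point ?n ?v w \<alpha> \<beta> | \<alpha> \<beta>. incremental_weights ?n \<alpha> \<beta>}" (is "?L = ?I")
  proof (intro equalityI subsetI)
    fix q assume "q \<in> ?L"
    then obtain x y \<alpha> \<beta> z where q: "q = (x, y)"
      and sys: "(x, y, \<alpha>, \<beta>, z) \<in> incremental_system {0..1} f p w"
      by (auto simp: proj_xy_def lp_relaxation_def)
    have first: "\<alpha> 1 + \<beta> 1 \<le> 1"
      and rest: "\<And>i. i \<in> {2..?n} \<Longrightarrow> \<alpha> i + \<beta> i \<le> z (i - 1) \<and> z (i - 1) \<le> \<beta> (i - 1)"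
      and bds: "\<alpha> \<in> {1..?n} \<rightarrow>\<^sub>E {0..1}" "\<beta> \<in> {1..?n} \<rightarrow>\<^sub>E {0..1}"
      using sys by (auto simp: incremental_system_def Let_def)
    have "incremental_weights ?n \<alpha> \<beta>"
      unfolding incremental_weights_def
    proof
      fix i assume i: "i \<in> {1..?n}"
      then have "0 \<le> \<alpha> i \<and> 0 \<le> \<beta> i"
        using bds by (auto dest!: PiE_mem)
      moreover have "\<alpha> i + \<beta> i \<le> (if i = 1 then 1 else \<beta> (i - 1))"
        using first rest[of i] i by auto
      ultimately show "0 \<le> \<alpha> i \<and> 0 \<le> \<beta> i \<and> \<alpha> i + \<beta> i \<le> (if i = 1 then 1 else \<beta> (i - 1))"
        by blast
    qed
    moreover have "q = incremental_point ?n ?v w \<alpha> \<beta>"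
      unfolding q point using sys by (simp add: incremental_system_def Let_def)
    ultimately show "q \<in> ?I"
      by blast
  next
    fix q assume "q \<in> ?I"
    then obtain \<alpha> \<beta> where q: "q = incremental_point ?n ?v w \<alpha> \<beta>"
      and wt: "incremental_weights ?n \<alpha> \<beta>"
      by blast
    \<comment> \<open>Of the values allowed for \<open>z\<close>, the largest one is taken; the restrictions only enforce the
      value \<open>undefined\<close> outside the index sets.\<close>
    let ?a = "restrict \<alpha> {1..?n}" and ?b = "restrict \<beta> {1..?n}" and ?z = "restrict \<beta> {1..<?n}"
    have wt': "0 \<le> \<alpha> i" "0 \<le> \<beta> i" "\<alpha> i + \<beta> i \<le> (if i = 1 then 1 else \<beta> (i - 1))"
      "\<alpha> i \<le> 1" "\<beta> i \<le> 1" if "i \<in> {1..?n}" for i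
      using wt incremental_weights_le_1[OF wt] that by (auto simp: incremental_weights_def)
    have "incremental_point ?n ?v w \<alpha> \<beta> = incremental_point ?n ?v w ?a ?b"
      unfolding incremental_point_def by (intro arg_cong2[of _ _ _ _ "(+)"] sum.cong) auto
    then have "q = incremental_point ?n ?v w ?a ?b"
      using q by simp
    moreover have "?a 1 + ?b 1 \<le> 1"
    proof -
      have "1 \<in> {1..?n}"
        using assms by auto
      then show ?thesis
        using wt'(3)[of 1] by simp
    qed
    moreover have "\<forall>i\<in>{2..?n}. ?a i + ?b i \<le> ?z (i - 1) \<and> ?z (i - 1) \<le> ?b (i - 1)"
    proof
      fix i assume "i \<in> {2..?n}"
      then show "?a i + ?b i \<le> ?z (i - 1) \<and> ?z (i - 1) \<le> ?b (i - 1)"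
        using wt'(3)[of i] by auto
    qed
    moreover have "?a \<in> {1..?n} \<rightarrow>\<^sub>E {0..1}" "?b \<in> {1..?n} \<rightarrow>\<^sub>E {0..1}" "?z \<in> {1..<?n} \<rightarrow>\<^sub>E {0..1}"
      using wt' by auto
    ultimately have "(fst q, snd q, ?a, ?b, ?z) \<in> incremental_system {0..1} f p w"
      unfolding incremental_system_def Let_def point by simp
    then show "q \<in> ?L"
      unfolding proj_xy_def lp_relaxation_def by force
  qed
  then show ?thesis
    by (simp only: incremental_points_eq_convex_hull)
qed

section \<open>Chords and tangents on a convex or concave piece\<close>

text \<open>What convexity (first disjunct) and concavity (second disjunct) of a differentiable function have
  in common, so that both curvatures can be treated at once: the slope of every chord lies between
  the derivatives at its ends.  This contains the monotonicity of \<open>f'\<close>, and it passes to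
  subintervals, hence survives bisection.\<close>

definition slopes_bracketed :: "(real \<Rightarrow> real) \<Rightarrow> (real \<Rightarrow> real) \<Rightarrow> real \<Rightarrow> real \<Rightarrow> bool" where
  "slopes_bracketed f f' a b \<longleftrightarrow>
     (\<forall>x y. a \<le> x \<and> x < y \<and> y \<le> b \<longrightarrow>
        f' x \<le> (f y - f x) / (y - x) \<and> (f y - f x) / (y - x) \<le> f' y) \<or>
     (\<forall>x y. a \<le> x \<and> x < y \<and> y \<le> b \<longrightarrow>
        f' y \<le> (f y - f x) / (y - x) \<and> (f y - f x) / (y - x) \<le> f' x)"

text \<open>Chord slopes of a convex function increase in either end point, and \<open>f' x\<close>, \<open>f' y\<close> are their
  limits as one end point approaches the other within \<open>{x..y}\<close>.  The one-sided derivatives at the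
  ends of the domain are covered because only chords inside \<open>{x..y}\<close> are compared.\<close>

lemma convex_on_slope_bounds:
  fixes f f' :: "real \<Rightarrow> real"
  assumes conv: "convex_on {a..b} f" and sub: "{a..b} \<subseteq> S"
    and deriv: "\<And>x. x \<in> S \<Longrightarrow> (f has_real_derivative f' x) (at x within S)"
    and xy: "a \<le> x" "x < y" "y \<le> b"
  shows "f' x \<le> (f y - f x) / (y - x)" "(f y - f x) / (y - x) \<le> f' y"
proof -
  have S: "{x..y} \<subseteq> S" "x \<in> S" "y \<in> S"
    using sub xy by auto
  have slope_commute: "(f s - f t) / (s - t) = (f t - f s) / (t - s)" for s t
    by (metis minus_diff_eq minus_divide_divide)
  have mid: "(f t - f x) / (t - x) \<le> (f y - f x) / (y - x)"
      "(f y - f x) / (y - x) \<le> (f t - f y) / (t - y)" if t: "x < t" "t < y" for t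
    using convex_on_slope_le[OF conv, of x y t] t xy
    unfolding slope_commute[of x t] slope_commute[of x y] by auto
  have "((\<lambda>t. (f t - f x) / (t - x)) \<longlongrightarrow> f' x) (at x within {x..y})"
    using has_field_derivative_subset[OF deriv[OF S(2)] S(1)] by (simp add: has_field_derivative_iff)
  then show "f' x \<le> (f y - f x) / (y - x)"
  proof (rule tendsto_upperbound)
    show "\<forall>\<^sub>F t in at x within {x..y}. (f t - f x) / (t - x) \<le> (f y - f x) / (y - x)"
      unfolding eventually_at_filter
    proof (intro always_eventually allI impI)
      fix t assume "t \<noteq> x" "t \<in> {x..y}"
      then show "(f t - f x) / (t - x) \<le> (f y - f x) / (y - x)"
        using mid(1)[of t] by (cases "t = y") auto
    qed
  qed (use xy in \<open>simp add: at_within_Icc_at_right\<close>)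
  have "((\<lambda>t. (f t - f y) / (t - y)) \<longlongrightarrow> f' y) (at y within {x..y})"
    using has_field_derivative_subset[OF deriv[OF S(3)] S(1)] by (simp add: has_field_derivative_iff)
  then show "(f y - f x) / (y - x) \<le> f' y"
  proof (rule tendsto_lowerbound)
    show "\<forall>\<^sub>F t in at y within {x..y}. (f y - f x) / (y - x) \<le> (f t - f y) / (t - y)"
      unfolding eventually_at_filter
    proof (intro always_eventually allI impI)
      fix t assume "t \<noteq> y" "t \<in> {x..y}"
      then show "(f y - f x) / (y - x) \<le> (f t - f y) / (t - y)"
        using mid(2)[of t] slope_commute[of x y] by (cases "t = x") auto
    qed
  qed (use xy in \<open>simp add: at_within_Icc_at_left\<close>)
qed

lemma slopes_bracketedI:
  fixes f f' :: "real \<Rightarrow> real"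
  assumes curved: "convex_on {a..b} f \<or> concave_on {a..b} f" and sub: "{a..b} \<subseteq> S"
    and deriv: "\<And>x. x \<in> S \<Longrightarrow> (f has_real_derivative f' x) (at x within S)"
  shows "slopes_bracketed f f' a b"
  using curved
proof
  assume "convex_on {a..b} f"
  then show ?thesis
    using convex_on_slope_bounds[OF _ sub deriv] by (auto simp: slopes_bracketed_def)
next
  assume "concave_on {a..b} f"
  then have conv: "convex_on {a..b} (\<lambda>x. - f x)"
    by (simp add: concave_on_def)
  have deriv': "((\<lambda>x. - f x) has_real_derivative - f' x) (at x within S)" if "x \<in> S" for x
    using deriv[OF that] by (rule DERIV_minus)
  have neg: "(- f y - - f x) / (y - x) = - ((f y - f x) / (y - x))" for x y
    by (metis minus_diff_minus minus_divide_left)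
  have "f' y \<le> (f y - f x) / (y - x) \<and> (f y - f x) / (y - x) \<le> f' x"
    if "a \<le> x \<and> x < y \<and> y \<le> b" for x y
    using convex_on_slope_bounds[OF conv sub deriv', of x y] that unfolding neg by auto
  then show ?thesis
    by (auto simp: slopes_bracketed_def)
qed

lemma slopes_bracketed_subinterval:
  assumes "slopes_bracketed f f' a b" "a \<le> c" "d \<le> b"
  shows "slopes_bracketed f f' c d"
  using assms unfolding slopes_bracketed_def by (meson order_trans)

text \<open>Both halves have half the length, and by monotonicity of \<open>f'\<close> the variations of \<open>f'\<close> on them add up
  to the variation on the whole interval.\<close>

lemma interval_bound_midpoint:
  assumes "slopes_bracketed f f' a b" "a < b"
  defines "m \<equiv> (a + b) / 2"
  shows "interval_bound f' a m + interval_bound f' m b = interval_bound f' a b / 2"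
proof -
  have "a < m" "m < b"
    using assms by auto
  then have "f' a \<le> f' m \<and> f' m \<le> f' b \<or> f' b \<le> f' m \<and> f' m \<le> f' a"
    using assms(1) unfolding slopes_bracketed_def by (meson order_refl order_trans less_imp_le)
  then have "\<bar>f' a - f' m\<bar> + \<bar>f' m - f' b\<bar> = \<bar>f' a - f' b\<bar>"
    by auto
  moreover have "interval_bound f' a m + interval_bound f' m b =
      (b - a) / 8 * (\<bar>f' a - f' m\<bar> + \<bar>f' m - f' b\<bar>)"
    by (simp add: interval_bound_def m_def field_simps)
  ultimately show ?thesis
    by (simp add: interval_bound_def)
qed

text \<open>The nearby point is the one on the chord vertically below or above \<open>(x, y)\<close>.\<close>

lemma near_chord:
  fixes f :: "real \<Rightarrow> real"
  assumes "a < b" "a \<le> x" "x \<le> b"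
    and "\<bar>y - (f a + (f b - f a) / (b - a) * (x - a))\<bar> \<le> e"
  shows "\<exists>c\<in>closed_segment (a, f a) (b, f b). dist (x, y) c \<le> e"
proof
  let ?t = "(x - a) / (b - a)" and ?h = "f a + (f b - f a) / (b - a) * (x - a)"
  have "?t * (b - a) = x - a"
    using assms by simp
  then have "x = (1 - ?t) * a + ?t * b"
    by (simp add: left_diff_distrib right_diff_distrib)
  moreover have "?h = (1 - ?t) * f a + ?t * f b"
    by (simp add: algebra_simps diff_divide_distrib)
  moreover have "0 \<le> ?t" "?t \<le> 1"
    using assms by auto
  ultimately show "(x, ?h) \<in> closed_segment (a, f a) (b, f b)"
    unfolding closed_segment_def by (intro CollectI exI[of _ ?t]) auto
  show "dist (x, y) (x, ?h) \<le> e"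
    using assms(4) by (simp add: dist_Pair_Pair dist_real_def)
qed

text \<open>The slope from \<open>a\<close> to \<open>x\<close> and the slope of the whole chord both lie between \<open>f' a\<close> and
  \<open>f' b\<close>, so the graph deviates from the chord by at most \<open>\<bar>f' a - f' b\<bar> * (b - a)\<close>.  This is four
  times the interval bound, which is enough for a convergence proof.\<close>

lemma graph_near_chord:
  assumes "slopes_bracketed f f' a b" "a < b" "a \<le> x" "x \<le> b"
  shows "\<exists>c\<in>closed_segment (a, f a) (b, f b). dist (x, f x) c \<le> 4 * interval_bound f' a b"
proof (rule near_chord)
  let ?D = "\<bar>f' a - f' b\<bar>" and ?s = "(f b - f a) / (b - a)" and ?r = "(f x - f a) / (x - a)"
  show "\<bar>f x - (f a + ?s * (x - a))\<bar> \<le> 4 * interval_bound f' a b"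
  proof (cases "x = a")
    case False
    then have "a < x"
      using assms by simp
    have "f' x \<le> f' b \<and> f' a \<le> ?r \<and> ?r \<le> f' x \<and> f' a \<le> ?s \<and> ?s \<le> f' b \<or>
        f' b \<le> f' x \<and> f' x \<le> ?r \<and> ?r \<le> f' a \<and> f' b \<le> ?s \<and> ?s \<le> f' a"
    proof (cases "x = b")
      case True
      then show ?thesis
        using assms unfolding slopes_bracketed_def by (metis order_refl)
    next
      case False
      then have "x < b"
        using assms by simp
      with \<open>a < x\<close> assms show ?thesis
        unfolding slopes_bracketed_def by (meson order_refl order_trans less_imp_le)
    qed
    then have "\<bar>?r - ?s\<bar> \<le> ?D"
      by auto
    moreover have "f x - (f a + ?s * (x - a)) = (?r - ?s) * (x - a)"
    proof -
      have "?r * (x - a) = f x - f a"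
        using \<open>a < x\<close> by simp
      then show ?thesis
        by (simp only: left_diff_distrib)
    qed
    ultimately have "\<bar>f x - (f a + ?s * (x - a))\<bar> \<le> ?D * (b - a)"
      using assms by (auto simp: abs_mult intro!: mult_mono)
    then show ?thesis
      by (simp add: interval_bound_def mult.commute)
  qed (use assms in \<open>auto simp: interval_bound_def\<close>)
qed (use assms in auto)

text \<open>If the tangents differ, then \<open>f' a \<noteq> f' b\<close>, because equal derivatives would coincide with the
  slope of the chord and make both tangents equal to its line.  The two tangent equations then
  place the abscissa of their intersection in \<open>{a..b}\<close>, where the tangent at \<open>a\<close> is as close to the
  chord as in \<open>graph_near_chord\<close>.\<close>

lemma tangent_vertex_near_chord:
  assumes "slopes_bracketed f f' a b" "a < b" and v: "is_tangent_vertex f f' a b v"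
  shows "\<exists>c\<in>closed_segment (a, f a) (b, f b). dist v c \<le> 4 * interval_bound f' a b"
proof (cases "tangent_line f f' a = tangent_line f f' b")
  case True
  then have "v \<in> closed_segment (a, f a) (b, f b)"
    using v by (simp add: is_tangent_vertex_def)
  then show ?thesis
    using \<open>a < b\<close> by (intro bexI[of _ v]) (auto simp: interval_bound_def)
next
  case False
  obtain x y where xy: "v = (x, y)"
    by fastforce
  let ?s = "(f b - f a) / (b - a)"
  have tang: "y = f a + f' a * (x - a)" "y = f b + f' b * (x - b)"
    using v False by (auto simp: is_tangent_vertex_def tangent_line_def xy)
  have chord: "f b = f a + ?s * (b - a)"
    using \<open>a < b\<close> by simp
  have s: "f' a \<le> ?s \<and> ?s \<le> f' b \<or> f' b \<le> ?s \<and> ?s \<le> f' a"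
    using assms(1,2) unfolding slopes_bracketed_def by (metis order_refl)
  have "f' a \<noteq> f' b"
  proof
    assume eq: "f' a = f' b"
    then have "?s = f' b"
      using s by auto
    then have "f a - f' a * a = f b - f' b * b"
      using chord eq by (simp add: algebra_simps)
    then have "tangent_line f f' a = tangent_line f f' b"
      by (auto simp: tangent_line_def eq algebra_simps)
    with False show False ..
  qed
  \<comment> \<open>The abscissa divides the interval in the ratio \<open>f' b - s : s - f' a\<close>, where \<open>s\<close> is the slope
    of the chord.\<close>
  have t: "(x - a) * (f' b - f' a) = (b - a) * (f' b - ?s)"
    "(b - x) * (f' b - f' a) = (b - a) * (?s - f' a)"
    using tang chord by algebra+
  \<comment> \<open>By the two equations, neither product has the sign opposite to \<open>f' b - f' a\<close>.\<close>
  have x: "a \<le> x" "x \<le> b"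
  proof -
    have "0 \<le> (x - a) * (f' b - f' a) \<and> 0 \<le> (b - x) * (f' b - f' a) \<and> f' a < f' b \<or>
        (x - a) * (f' b - f' a) \<le> 0 \<and> (b - x) * (f' b - f' a) \<le> 0 \<and> f' b < f' a"
      unfolding t using s \<open>a < b\<close> \<open>f' a \<noteq> f' b\<close>
      by (auto simp: zero_le_mult_iff mult_le_0_iff)
    then show "a \<le> x" "x \<le> b"
      by (auto simp: zero_le_mult_iff mult_le_0_iff)
  qed
  have "y - (f a + ?s * (x - a)) = (f' a - ?s) * (x - a)"
    unfolding tang(1) by (simp only: left_diff_distrib)
  then have "\<bar>y - (f a + ?s * (x - a))\<bar> = \<bar>f' a - ?s\<bar> * (x - a)"
    using x by (simp add: abs_mult)
  also have "\<dots> \<le> \<bar>f' a - f' b\<bar> * (b - a)"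
    using s x by (intro mult_mono) auto
  finally show ?thesis
    unfolding xy using \<open>a < b\<close> x by (intro near_chord) (auto simp: interval_bound_def mult.commute)
qed

section \<open>Bisection and the total bound\<close>

text \<open>The invariant of the bisection procedure.  It is stated for neighbouring points only, so that
  inserting a midpoint affects just one of its conditions.\<close>

definition bracketed_partition ::
    "(real \<Rightarrow> real) \<Rightarrow> (real \<Rightarrow> real) \<Rightarrow> real \<Rightarrow> real \<Rightarrow> real list \<Rightarrow> bool" where
  "bracketed_partition f f' l u p \<longleftrightarrow> p \<noteq> [] \<and> hd p = l \<and> last p = u \<and>
     successively (\<lambda>a b. a < b \<and> slopes_bracketed f f' a b) p"

fun total_interval_bound :: "(real \<Rightarrow> real) \<Rightarrow> real list \<Rightarrow> real" where
  "total_interval_bound f' (a # b # xs) = interval_bound f' a b + total_interval_bound f' (b # xs)"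
| "total_interval_bound f' _ = 0"

lemma total_interval_bound_insert:
  "total_interval_bound f' (xs @ a # m # b # ys) =
     total_interval_bound f' (xs @ a # b # ys)
     + (interval_bound f' a m + interval_bound f' m b - interval_bound f' a b)"
proof (induction xs)
  case (Cons x xs)
  then show ?case
    by (cases xs) auto
qed auto

lemma total_interval_bound_nonneg:
  "successively (\<lambda>a b. a < b \<and> Q a b) p \<Longrightarrow> 0 \<le> total_interval_bound f' p"
  by (induction p rule: induct_list012) (auto simp: interval_bound_def)

lemma bisect_split:
  assumes "Suc i < length p"
  obtains xs a b ys where "a = p ! i" "b = p ! Suc i"
    "p = xs @ a # b # ys" "bisect p i = xs @ a # (a + b) / 2 # b # ys"
proof
  have "drop i p = p ! i # p ! Suc i # drop (Suc (Suc i)) p"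
    using assms by (metis Cons_nth_drop_Suc Suc_lessD)
  then show "p = take i p @ p ! i # p ! Suc i # drop (Suc (Suc i)) p"
    by (metis append_take_drop_id)
  show "bisect p i =
      take i p @ p ! i # (p ! i + p ! Suc i) / 2 # p ! Suc i # drop (Suc (Suc i)) p"
    using assms by (simp add: bisect_def take_Suc_conv_app_nth Cons_nth_drop_Suc)
qed (rule refl)+

text \<open>The interval that is bisected contributes half as much afterwards; nothing else changes.\<close>

lemma
  assumes p: "bracketed_partition f f' l u p" and i: "Suc i < length p"
  shows bracketed_partition_bisect:
      "bracketed_partition f f' l u (bisect p i)"
    and total_interval_bound_bisect:
      "total_interval_bound f' (bisect p i) =
         total_interval_bound f' p - interval_bound f' (p ! i) (p ! Suc i) / 2"
proof -
  obtain xs a b ys where ab: "a = p ! i" "b = p ! Suc i"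
    and p_eq: "p = xs @ a # b # ys" and q_eq: "bisect p i = xs @ a # (a + b) / 2 # b # ys"
    using bisect_split[OF i] .
  define m where "m = (a + b) / 2"
  have "a < b" and br: "slopes_bracketed f f' a b"
    using p i unfolding ab bracketed_partition_def successively_conv_nth by blast+
  then have m: "a < m" "m < b"
    by (auto simp: m_def)
  then have "slopes_bracketed f f' a m" "slopes_bracketed f f' m b"
    using br by (auto intro: slopes_bracketed_subinterval)
  moreover have "bracketed_partition f f' l u (xs @ a # b # ys)"
    using p p_eq by metis
  ultimately have "bracketed_partition f f' l u (xs @ a # m # b # ys)"
    using m unfolding bracketed_partition_def
    by (auto simp: successively_append_iff hd_append)
  then show "bracketed_partition f f' l u (bisect p i)"
    by (simp only: q_eq m_def)
  have "total_interval_bound f' (xs @ a # m # b # ys) =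
      total_interval_bound f' (xs @ a # b # ys) - interval_bound f' a b / 2"
    unfolding total_interval_bound_insert
    using interval_bound_midpoint[OF br \<open>a < b\<close>] by (simp add: m_def)
  then show "total_interval_bound f' (bisect p i) =
      total_interval_bound f' p - interval_bound f' (p ! i) (p ! Suc i) / 2"
    using ab p_eq q_eq m_def by metis
qed

lemma successively_less_cover:
  fixes p :: "'a::linorder list"
  assumes "successively (\<lambda>a b. a < b \<and> Q a b) p" "2 \<le> length p" "hd p \<le> x" "x \<le> last p"
  shows "\<exists>i. Suc i < length p \<and> p ! i \<le> x \<and> x \<le> p ! Suc i"
  using assms
proof (induction p rule: induct_list012)
  case (3 a b xs)
  show ?case
  proof (cases "x \<le> b \<or> xs = []")
    case True
    then show ?thesis
      using 3(5,6) by (intro exI[of _ 0]) auto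
  next
    case False
    then have "\<exists>i. Suc i < length (b # xs) \<and> (b # xs) ! i \<le> x \<and> x \<le> (b # xs) ! Suc i"
      using 3(3-) by (intro 3(2)) (auto simp: Suc_le_eq)
    then obtain i where "Suc i < length (b # xs)" "(b # xs) ! i \<le> x" "x \<le> (b # xs) ! Suc i"
      by blast
    then show ?thesis
      by (intro exI[of _ "Suc i"]) auto
  qed
qed auto

lemma bracketed_partition_points:
  assumes "bracketed_partition f f' l u p" "i < length p"
  shows "p ! i \<in> {l..u}"
proof -
  have "successively (<) p"
    using assms(1) unfolding bracketed_partition_def by (auto elim: successively_mono)
  then have "sorted_wrt (<) p"
    by (simp add: successively_conv_sorted_wrt transp_on_less)
  then have "sorted p"
    by (simp add: strict_sorted_imp_sorted)
  then show ?thesis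
    using assms sorted_nth_mono[of p 0 i] sorted_nth_mono[of p i "length p - 1"]
    by (auto simp: bracketed_partition_def hd_conv_nth last_conv_nth)
qed

section \<open>Convergence of the relaxations\<close>

text \<open>The chord over a sub-interval lies in both convex hulls and is the common neighbour of the graph
  and of the tangent intersection over that sub-interval.\<close>

lemma hausdorff_dist_relaxation:
  fixes f f' :: "real \<Rightarrow> real" and p :: "real list"
  assumes p: "bracketed_partition f f' l u p" and len: "2 \<le> length p"
    and vertices: "tangent_vertices f f' p w"
    and M: "\<And>i. Suc i < length p \<Longrightarrow> interval_bound f' (p ! i) (p ! Suc i) \<le> M"
  shows "hausdorff_dist (proj_xy (lp_relaxation f p w))
    (convex hull {(x, y). x \<in> {l..u} \<and> y = f x}) \<in> {0..4 * M}"
proof -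
  let ?n = "length p - 1" and ?v = "\<lambda>i. (p ! i, f (p ! i))"
  let ?S = "?v ` {0..?n} \<union> w ` {1..?n}" and ?T = "{(x, y). x \<in> {l..u} \<and> y = f x}"
  have pieces: "p ! i < p ! Suc i" "slopes_bracketed f f' (p ! i) (p ! Suc i)"
    if "Suc i < length p" for i
    using p that unfolding bracketed_partition_def successively_conv_nth by blast+
  have v_in_T: "?v i \<in> ?T" if "i < length p" for i
    using bracketed_partition_points[OF p that] by auto
  have "0 \<le> interval_bound f' (p ! 0) (p ! Suc 0)"
    using pieces(1)[of 0] len by (simp add: interval_bound_def)
  then have "0 \<le> M"
    using M[of 0] len by simp
  have "hausdorff_dist (convex hull ?S) (convex hull ?T) \<in> {0..4 * M}"
  proof (rule hausdorff_dist_convex_hulls)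
    show "?S \<noteq> {}"
      by auto
    have "?v 0 \<in> ?T"
      using len by (intro v_in_T) linarith
    then show "?T \<noteq> {}"
      by blast
  next
    fix s assume "s \<in> ?S"
    then consider i where "i < length p" "s = ?v i" | i where "Suc i < length p" "s = w (Suc i)"
    proof
      assume "s \<in> ?v ` {0..?n}"
      then obtain j where "j \<in> {0..?n}" "s = ?v j"
        by blast
      then show ?thesis
        using len by (intro that(1)[of j]) auto
    next
      assume "s \<in> w ` {1..?n}"
      then obtain j where "j \<in> {1..?n}" "s = w j"
        by blast
      then show ?thesis
        using that(2)[of "j - 1"] by force
    qed
    then show "\<exists>t\<in>convex hull ?T. dist s t \<le> 4 * M"
    proof cases
      case 1
      then show ?thesis
        using v_in_T \<open>0 \<le> M\<close> by (intro bexI[of _ s]) (auto intro: hull_inc)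
    next
      case (2 i)
      then have "is_tangent_vertex f f' (p ! i) (p ! Suc i) s"
        using vertices unfolding tangent_vertices_def by force
      then obtain c where "c \<in> closed_segment (?v i) (?v (Suc i))"
        "dist s c \<le> 4 * interval_bound f' (p ! i) (p ! Suc i)"
        using tangent_vertex_near_chord pieces[OF 2(1)] by blast
      moreover have "closed_segment (?v i) (?v (Suc i)) \<subseteq> convex hull ?T"
        using 2 by (intro closed_segment_subset_convex_hull hull_inc v_in_T) auto
      ultimately show ?thesis
        using M[OF 2(1)] by force
    qed
  next
    fix t assume "t \<in> ?T"
    then obtain x where x: "t = (x, f x)" "l \<le> x" "x \<le> u"
      by auto
    then obtain i where i: "Suc i < length p" "p ! i \<le> x" "x \<le> p ! Suc i"
      using successively_less_cover[of "slopes_bracketed f f'" p x] p len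
      unfolding bracketed_partition_def by auto
    then obtain c where "c \<in> closed_segment (?v i) (?v (Suc i))"
      "dist t c \<le> 4 * interval_bound f' (p ! i) (p ! Suc i)"
      using graph_near_chord[OF pieces(2,1)[OF i(1)] i(2,3)] x by blast
    moreover have "closed_segment (?v i) (?v (Suc i)) \<subseteq> convex hull ?S"
      using i by (intro closed_segment_subset_convex_hull hull_inc) auto
    ultimately show "\<exists>s\<in>convex hull ?S. dist t s \<le> 4 * M"
      using M[OF i(1)] by force
  qed
  then show ?thesis
    by (simp only: proj_lp_relaxation[OF len])
qed

theorem theorem2:
  fixes f f' :: "real \<Rightarrow> real" and l u :: real
    and p0 :: "real list" and p :: "nat \<Rightarrow> real list"
    and w :: "nat \<Rightarrow> nat \<Rightarrow> real \<times> real"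
  assumes "l < u"
    and nonlinear: "\<not> (\<exists>m c. \<forall>x\<in>{l..u}. f x = m * x + c)"
    and bounded: "bounded (f ` {l..u})"
    and deriv: "\<And>x. x \<in> {l..u} \<Longrightarrow> (f has_real_derivative f' x) (at x within {l..u})"
    and base: "is_base_partition f f' l u p0"
    and curvature: "\<And>i. Suc i < length p0 \<Longrightarrow>
          convex_on {p0 ! i..p0 ! Suc i} f \<or> concave_on {p0 ! i..p0 ! Suc i} f"
    and start: "p 0 = p0"
    and step: "\<And>k. max_bound_bisection f' (p k) (p (Suc k))"
    and vertices: "\<And>k. tangent_vertices f f' (p k) (w k)"
  shows "(\<lambda>k. hausdorff_dist (proj_xy (lp_relaxation f (p k) (w k)))
                (convex hull {(x, y). x \<in> {l..u} \<and> y = f x})) \<longlonglongrightarrow> 0"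
proof -
  have "bracketed_partition f f' l u p0"
  proof -
    have part: "is_partition l u p0"
      using base by (simp add: is_base_partition_def separating_partition_def)
    then have "sorted p0"
      by (auto simp: is_partition_def strict_sorted_imp_sorted)
    have "p0 ! i < p0 ! Suc i \<and> slopes_bracketed f f' (p0 ! i) (p0 ! Suc i)"
      if i: "Suc i < length p0" for i
    proof
      show "p0 ! i < p0 ! Suc i"
        using part i by (simp add: is_partition_def sorted_wrt_nth_less)
      have "l \<le> p0 ! i" "p0 ! Suc i \<le> u"
        using part i sorted_nth_mono[OF \<open>sorted p0\<close>, of 0 i]
          sorted_nth_mono[OF \<open>sorted p0\<close>, of "Suc i" "length p0 - 1"]
        by (auto simp: is_partition_def hd_conv_nth last_conv_nth)
      then show "slopes_bracketed f f' (p0 ! i) (p0 ! Suc i)"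
        using curvature[OF i] deriv by (intro slopes_bracketedI[of _ _ _ "{l..u}"]) auto
    qed
    then show ?thesis
      using part by (simp add: bracketed_partition_def is_partition_def successively_conv_nth)
  qed
  have "\<exists>i. \<forall>k. Suc (i k) < length (p k) \<and> p (Suc k) = bisect (p k) (i k) \<and>
      (\<forall>j. Suc j < length (p k) \<longrightarrow> interval_bound f' (p k ! j) (p k ! Suc j)
        \<le> interval_bound f' (p k ! i k) (p k ! Suc (i k)))"
    using step unfolding max_bound_bisection_def by metis
  then obtain i where i: "\<And>k. Suc (i k) < length (p k)"
    and bis: "\<And>k. p (Suc k) = bisect (p k) (i k)"
    and maximal: "\<And>k j. Suc j < length (p k) \<Longrightarrow> interval_bound f' (p k ! j) (p k ! Suc j)
      \<le> interval_bound f' (p k ! i k) (p k ! Suc (i k))"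
    by blast
  define M where "M k = interval_bound f' (p k ! i k) (p k ! Suc (i k))" for k
  have br: "bracketed_partition f f' l u (p k)" for k
  proof (induction k)
    case 0
    show ?case
      using \<open>bracketed_partition f f' l u p0\<close> start by simp
  next
    case (Suc k)
    then show ?case
      unfolding bis using i by (rule bracketed_partition_bisect)
  qed
  define S where "S k = total_interval_bound f' (p k)" for k
  have S_Suc: "S (Suc k) = S k - M k / 2" for k
    unfolding S_def M_def bis using br i by (rule total_interval_bound_bisect)
  have "0 \<le> S k" for k
    using br[of k] unfolding S_def bracketed_partition_def by (auto intro: total_interval_bound_nonneg)
  have dist: "hausdorff_dist (proj_xy (lp_relaxation f (p k) (w k)))
      (convex hull {(x, y). x \<in> {l..u} \<and> y = f x}) \<in> {0..4 * M k}" for k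
    using i[of k] vertices[of k] maximal[of _ k]
    by (intro hausdorff_dist_relaxation[OF br]) (auto simp: M_def)
  have "0 \<le> M k" for k
    using dist[of k] by auto
  then have "decseq S"
    by (intro decseq_SucI) (simp add: S_Suc)
  then obtain L where "S \<longlonglongrightarrow> L"
    using decseq_convergent[of S 0] \<open>\<And>k. 0 \<le> S k\<close> by blast
  then have "(\<lambda>k. 8 * (S k - S (Suc k))) \<longlonglongrightarrow> 8 * (L - L)"
    by (intro tendsto_intros LIMSEQ_Suc)
  moreover have "8 * (S k - S (Suc k)) = 4 * M k" for k
    by (simp add: S_Suc)
  ultimately have lim: "(\<lambda>k. 4 * M k) \<longlonglongrightarrow> 0"
    by simp
  show ?thesis
    by (rule tendsto_sandwich[OF _ _ tendsto_const lim]) (use dist in auto)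
qed

end
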